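(* Let $\Bbbk=(\Bbbk_\alpha)_{\alpha\in\mathrm{ON}}$ be an ordinal-indexed tower of fields with $\Bbbk_\alpha\subset\Bbbk_\beta$ of infinite degree whenever $\alpha<\beta$. For every ordinal $\alpha$, the category $\mathcal{C}_{\Bbbk,\alpha}$ of $\alpha$-grounded chains is not abelian.
   Context: Set theory: ZFC (with proper classes treated in the metatheory) or NBG with choice. $\mathrm{ON}$ is the (large) well-ordered class of ordinals. The tower is a functor $\alpha\mapsto\Bbbk_\alpha$ from $(\mathrm{ON},\le)$ to fields, its maps viewed as inclusions $\Bbbk_\alpha\subset\Bbbk_\beta$ for $\alpha\le\beta$, with $\Bbbk_\beta$ of infinite degree over $\Bbbk_\alpha$ whenever $\alpha<\beta$. Let $\overline{\mathcal{C}}_{\Bbbk}$ have as objects families $V=(V_\alpha)_{\alpha\in\mathrm{ON}}$ of $\Bbbk_\alpha$-vector spaces with $\Bbbk_\alpha$-linear maps $\nu_{\beta\alpha}:V_\alpha\to V_\beta$ for $\alpha\le\beta$, satisfying $\nu_{\alpha\alpha}=\mathrm{id}$ and $\nu_{\gamma\beta}\nu_{\beta\alpha}=\nu_{\gamma\alpha}$; morphisms are families of $\Bbbk_\alpha$-linear maps $V_\alpha\to W_\alpha$ commuting with the $\nu$'s. An object is $\alpha$-grounded if for all $\beta>\alpha$, $V_\beta$ is the $\Bbbk_\beta$-span of $\nu_{\beta\alpha}(V_\alpha)$. $\mathcal{C}_{\Bbbk,\alpha}$ is the full subcategory of $\overline{\mathcal{C}}_{\Bbbk}$ on the $\alpha$-grounded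 objects. *)

theory Defs
  imports
    "HOL-Library.FuncSet"
    "HOL-Algebra.Embedded_Algebras"
    "Jordan_Normal_Form.Missing_VectorSpace"
begin

section \<open>The set-theoretic universe\<close>

text \<open>
  A type of class \<open>zfc\<close> is a universe of sets: its elements are the sets, and
  its membership relation satisfies the axioms of ZFC. Classes are subsets \<open>'a set\<close> of the
  type and class functions are HOL functions, so separation and replacement are stated for
  arbitrary predicates and functions.
\<close>

class zfc =
  fixes elt :: "'a \<Rightarrow> 'a \<Rightarrow> bool"  (infix \<open>\<epsilon>\<close> 50)
  assumes extensionality: "(\<forall>z. z \<epsilon> x \<longleftrightarrow> z \<epsilon> y) \<Longrightarrow> x = y"
    and foundation: "\<exists>y. y \<epsilon> x \<Longrightarrow> \<exists>y. y \<epsilon> x \<and> \<not> (\<exists>z. z \<epsilon> y \<and> z \<epsilon> x)"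
    and pairing: "\<exists>p. \<forall>z. z \<epsilon> p \<longleftrightarrow> z = x \<or> z = y"
    and union: "\<exists>u. \<forall>z. z \<epsilon> u \<longleftrightarrow> (\<exists>y. y \<epsilon> x \<and> z \<epsilon> y)"
    and power_set: "\<exists>p. \<forall>y. y \<epsilon> p \<longleftrightarrow> (\<forall>z. z \<epsilon> y \<longrightarrow> z \<epsilon> x)"
    and infinity: "\<exists>w. (\<exists>e. e \<epsilon> w \<and> \<not> (\<exists>z. z \<epsilon> e)) \<and>
      (\<forall>x. x \<epsilon> w \<longrightarrow> (\<exists>s. s \<epsilon> w \<and> (\<forall>z. z \<epsilon> s \<longleftrightarrow> z \<epsilon> x \<or> z = x)))"
    and separation: "\<exists>y. \<forall>z. z \<epsilon> y \<longleftrightarrow> z \<epsilon> x \<and> P z"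
    and replacement: "\<exists>y. \<forall>z. z \<epsilon> y \<longleftrightarrow> (\<exists>w. w \<epsilon> x \<and> z = F w)"
    and choice: "(\<forall>y. y \<epsilon> x \<longrightarrow> (\<exists>z. z \<epsilon> y)) \<Longrightarrow>
      (\<forall>y y' z. y \<epsilon> x \<and> y' \<epsilon> x \<and> z \<epsilon> y \<and> z \<epsilon> y' \<longrightarrow> y = y') \<Longrightarrow>
      \<exists>c. \<forall>y. y \<epsilon> x \<longrightarrow> (\<exists>!z. z \<epsilon> y \<and> z \<epsilon> c)"

definition is_set :: "'u::zfc set \<Rightarrow> bool" where
  "is_set A \<longleftrightarrow> (\<exists>a. A = {x. x \<epsilon> a})"

definition transitive :: "'u::zfc \<Rightarrow> bool" where
  "transitive a \<longleftrightarrow> (\<forall>x y. y \<epsilon> x \<and> x \<epsilon> a \<longrightarrow> y \<epsilon> a)"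

text \<open>Von Neumann ordinals; by foundation, a transitive set of transitive sets is
  well-ordered by membership.\<close>

definition ON :: "'u::zfc set" where
  "ON = {a. transitive a \<and> (\<forall>x. x \<epsilon> a \<longrightarrow> transitive x)}"

abbreviation ord_less :: "'u::zfc \<Rightarrow> 'u \<Rightarrow> bool"  (infix \<open>\<prec>\<close> 50) where
  "\<alpha> \<prec> \<beta> \<equiv> \<alpha> \<epsilon> \<beta>"

definition ord_le :: "'u::zfc \<Rightarrow> 'u \<Rightarrow> bool"  (infix \<open>\<preceq>\<close> 50) where
  "\<alpha> \<preceq> \<beta> \<longleftrightarrow> \<alpha> \<prec> \<beta> \<or> \<alpha> = \<beta>"


section \<open>Categories and abelian categories\<close>

text \<open>\<open>Comp C X Y Z g f\<close> is the composite of \<open>f : X \<rightarrow> Y\<close> and \<open>g : Y \<rightarrow> Z\<close>.\<close>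

record ('o, 'm) category =
  Ob :: "'o set"
  Hom :: "'o \<Rightarrow> 'o \<Rightarrow> 'm set"
  Id :: "'o \<Rightarrow> 'm"
  Comp :: "'o \<Rightarrow> 'o \<Rightarrow> 'o \<Rightarrow> 'm \<Rightarrow> 'm \<Rightarrow> 'm"

locale category =
  fixes C :: "('o, 'm) category"
  assumes Id_in_Hom: "X \<in> Ob C \<Longrightarrow> Id C X \<in> Hom C X X"
    and Comp_in_Hom: "\<lbrakk>X \<in> Ob C; Y \<in> Ob C; Z \<in> Ob C; f \<in> Hom C X Y; g \<in> Hom C Y Z\<rbrakk>
      \<Longrightarrow> Comp C X Y Z g f \<in> Hom C X Z"
    and Comp_Id: "\<lbrakk>X \<in> Ob C; Y \<in> Ob C; f \<in> Hom C X Y\<rbrakk> \<Longrightarrow> Comp C X X Y f (Id C X) = f"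
    and Id_Comp: "\<lbrakk>X \<in> Ob C; Y \<in> Ob C; f \<in> Hom C X Y\<rbrakk> \<Longrightarrow> Comp C X Y Y (Id C Y) f = f"
    and Comp_assoc: "\<lbrakk>W \<in> Ob C; X \<in> Ob C; Y \<in> Ob C; Z \<in> Ob C;
        f \<in> Hom C W X; g \<in> Hom C X Y; h \<in> Hom C Y Z\<rbrakk>
      \<Longrightarrow> Comp C W Y Z h (Comp C W X Y g f) = Comp C W X Z (Comp C X Y Z h g) f"

definition full_subcategory :: "('o, 'm) category \<Rightarrow> ('o \<Rightarrow> bool) \<Rightarrow> ('o, 'm) category" where
  "full_subcategory C P = C\<lparr>Ob := {X \<in> Ob C. P X}\<rparr>"

definition monic :: "('o, 'm) category \<Rightarrow> 'o \<Rightarrow> 'o \<Rightarrow> 'm \<Rightarrow> bool" where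
  "monic C X Y m \<longleftrightarrow> m \<in> Hom C X Y \<and>
    (\<forall>T\<in>Ob C. \<forall>f\<in>Hom C T X. \<forall>g\<in>Hom C T X. Comp C T X Y m f = Comp C T X Y m g \<longrightarrow> f = g)"

definition epic :: "('o, 'm) category \<Rightarrow> 'o \<Rightarrow> 'o \<Rightarrow> 'm \<Rightarrow> bool" where
  "epic C X Y e \<longleftrightarrow> e \<in> Hom C X Y \<and>
    (\<forall>T\<in>Ob C. \<forall>f\<in>Hom C Y T. \<forall>g\<in>Hom C Y T. Comp C X Y T f e = Comp C X Y T g e \<longrightarrow> f = g)"

definition zero_object :: "('o, 'm) category \<Rightarrow> 'o \<Rightarrow> bool" where
  "zero_object C Z \<longleftrightarrow> Z \<in> Ob C \<and>
    (\<forall>X\<in>Ob C. (\<exists>!f. f \<in> Hom C X Z) \<and> (\<exists>!f. f \<in> Hom C Z X))"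

definition zero_morphism :: "('o, 'm) category \<Rightarrow> 'o \<Rightarrow> 'o \<Rightarrow> 'm \<Rightarrow> bool" where
  "zero_morphism C X Y f \<longleftrightarrow>
    (\<exists>Z. zero_object C Z \<and> (\<exists>g\<in>Hom C X Z. \<exists>h\<in>Hom C Z Y. f = Comp C X Z Y h g))"

text \<open>\<open>is_kernel C X Y f K k\<close>: the morphism \<open>k : K \<rightarrow> X\<close> is a kernel of \<open>f : X \<rightarrow> Y\<close>; dually,
  \<open>is_cokernel C X Y f Q q\<close>: the morphism \<open>q : Y \<rightarrow> Q\<close> is a cokernel of \<open>f : X \<rightarrow> Y\<close>.\<close>

definition is_kernel :: "('o, 'm) category \<Rightarrow> 'o \<Rightarrow> 'o \<Rightarrow> 'm \<Rightarrow> 'o \<Rightarrow> 'm \<Rightarrow> bool" where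
  "is_kernel C X Y f K k \<longleftrightarrow> K \<in> Ob C \<and> k \<in> Hom C K X \<and>
    zero_morphism C K Y (Comp C K X Y f k) \<and>
    (\<forall>T\<in>Ob C. \<forall>t\<in>Hom C T X. zero_morphism C T Y (Comp C T X Y f t) \<longrightarrow>
      (\<exists>!u. u \<in> Hom C T K \<and> Comp C T K X k u = t))"

definition is_cokernel :: "('o, 'm) category \<Rightarrow> 'o \<Rightarrow> 'o \<Rightarrow> 'm \<Rightarrow> 'o \<Rightarrow> 'm \<Rightarrow> bool" where
  "is_cokernel C X Y f Q q \<longleftrightarrow> Q \<in> Ob C \<and> q \<in> Hom C Y Q \<and>
    zero_morphism C X Q (Comp C X Y Q q f) \<and>
    (\<forall>T\<in>Ob C. \<forall>t\<in>Hom C Y T. zero_morphism C X T (Comp C X Y T t f) \<longrightarrow>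
      (\<exists>!u. u \<in> Hom C Q T \<and> Comp C Y Q T u q = t))"

text \<open>An Ab-enrichment: \<open>hadd X Y\<close> is a commutative group law on \<open>Hom C X Y\<close>, and composition is
  biadditive.\<close>

definition preadditive :: "('o, 'm) category \<Rightarrow> ('o \<Rightarrow> 'o \<Rightarrow> 'm \<Rightarrow> 'm \<Rightarrow> 'm) \<Rightarrow> bool" where
  "preadditive C hadd \<longleftrightarrow>
    (\<forall>X\<in>Ob C. \<forall>Y\<in>Ob C. \<exists>z. comm_group \<lparr>carrier = Hom C X Y, mult = hadd X Y, one = z\<rparr>) \<and>
    (\<forall>X\<in>Ob C. \<forall>Y\<in>Ob C. \<forall>Z\<in>Ob C. \<forall>f\<in>Hom C X Y. \<forall>f'\<in>Hom C X Y. \<forall>g\<in>Hom C Y Z. \<forall>g'\<in>Hom C Y Z.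
      Comp C X Y Z g (hadd X Y f f') = hadd X Z (Comp C X Y Z g f) (Comp C X Y Z g f') \<and>
      Comp C X Y Z (hadd Y Z g g') f = hadd X Z (Comp C X Y Z g f) (Comp C X Y Z g' f))"

definition has_biproducts :: "('o, 'm) category \<Rightarrow> ('o \<Rightarrow> 'o \<Rightarrow> 'm \<Rightarrow> 'm \<Rightarrow> 'm) \<Rightarrow> bool" where
  "has_biproducts C hadd \<longleftrightarrow>
    (\<forall>X\<in>Ob C. \<forall>Y\<in>Ob C. \<exists>S\<in>Ob C.
      \<exists>i\<in>Hom C X S. \<exists>j\<in>Hom C Y S. \<exists>p\<in>Hom C S X. \<exists>q\<in>Hom C S Y.
        Comp C X S X p i = Id C X \<and> Comp C Y S Y q j = Id C Y \<and>
        hadd S S (Comp C S X S i p) (Comp C S Y S j q) = Id C S)"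

text \<open>The additive structure of an abelian category is unique, so being abelian is a property of
  the category; here it is the existence of a suitable additive structure.\<close>

definition abelian_category :: "('o, 'm) category \<Rightarrow> bool" where
  "abelian_category C \<longleftrightarrow> category C \<and>
    (\<exists>hadd. preadditive C hadd \<and> has_biproducts C hadd) \<and>
    (\<exists>Z. zero_object C Z) \<and>
    (\<forall>X\<in>Ob C. \<forall>Y\<in>Ob C. \<forall>f\<in>Hom C X Y.
      (\<exists>K k. is_kernel C X Y f K k) \<and> (\<exists>Q q. is_cokernel C X Y f Q q)) \<and>
    (\<forall>X\<in>Ob C. \<forall>Y\<in>Ob C. \<forall>m. monic C X Y m \<longrightarrow>
      (\<exists>Z\<in>Ob C. \<exists>f\<in>Hom C Y Z. is_kernel C Y Z f X m)) \<and>
    (\<forall>X\<in>Ob C. \<forall>Y\<in>Ob C. \<forall>e. epic C X Y e \<longrightarrow>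
      (\<exists>W\<in>Ob C. \<exists>f\<in>Hom C W X. is_cokernel C W X f Y e))"


section \<open>Towers of fields and chains of vector spaces\<close>

text \<open>\<open>\<iota> \<beta> \<alpha>\<close> is the embedding of \<open>\<kk> \<alpha>\<close> into \<open>\<kk> \<beta>\<close> for \<open>\<alpha> \<preceq> \<beta>\<close> (a homomorphism
  of fields is injective). Values of the families at other indices are irrelevant.\<close>

locale field_tower =
  fixes \<kk> :: "'u::zfc \<Rightarrow> 'u ring"
    and \<iota> :: "'u \<Rightarrow> 'u \<Rightarrow> 'u \<Rightarrow> 'u"
  assumes field: "\<alpha> \<in> ON \<Longrightarrow> field (\<kk> \<alpha>)"
    and is_set: "\<alpha> \<in> ON \<Longrightarrow> is_set (carrier (\<kk> \<alpha>))"
    and hom: "\<lbrakk>\<alpha> \<in> ON; \<beta> \<in> ON; \<alpha> \<preceq> \<beta>\<rbrakk> \<Longrightarrow> \<iota> \<beta> \<alpha> \<in> ring_hom (\<kk> \<alpha>) (\<kk> \<beta>)"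
    and id: "\<lbrakk>\<alpha> \<in> ON; a \<in> carrier (\<kk> \<alpha>)\<rbrakk> \<Longrightarrow> \<iota> \<alpha> \<alpha> a = a"
    and comp: "\<lbrakk>\<alpha> \<in> ON; \<beta> \<in> ON; \<gamma> \<in> ON; \<alpha> \<preceq> \<beta>; \<beta> \<preceq> \<gamma>; a \<in> carrier (\<kk> \<alpha>)\<rbrakk>
      \<Longrightarrow> \<iota> \<gamma> \<beta> (\<iota> \<beta> \<alpha> a) = \<iota> \<gamma> \<alpha> a"
    and infinite_degree: "\<lbrakk>\<alpha> \<in> ON; \<beta> \<in> ON; \<alpha> \<prec> \<beta>\<rbrakk>
      \<Longrightarrow> \<not> ring.finite_dimension (\<kk> \<beta>) (\<iota> \<beta> \<alpha> ` carrier (\<kk> \<alpha>)) (carrier (\<kk> \<beta>))"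

definition restrict_scalars :: "('a \<Rightarrow> 'b) \<Rightarrow> ('b, 'v) module \<Rightarrow> ('a, 'v) module" where
  "restrict_scalars \<phi> M = \<lparr>carrier = carrier M, mult = mult M, one = one M,
    zero = zero M, add = add M, smult = (\<lambda>a. smult M (\<phi> a))\<rparr>"

text \<open>\<open>transition V \<beta> \<alpha>\<close> is the transition map from \<open>space V \<alpha>\<close> to \<open>space V \<beta>\<close>.
  Values outside \<open>ON\<close> and outside the carriers are unconstrained and invisible to the morphisms:
  two chains that differ only there are isomorphic. The same holds for the multiplicative fields
  of the \<open>module\<close> record.\<close>

record 'u chain =
  space :: "'u \<Rightarrow> ('u, 'u) module"
  transition :: "'u \<Rightarrow> 'u \<Rightarrow> 'u \<Rightarrow> 'u"

definition chains :: "('u::zfc \<Rightarrow> 'u ring) \<Rightarrow> ('u \<Rightarrow> 'u \<Rightarrow> 'u \<Rightarrow> 'u) \<Rightarrow> 'u chain set" where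
  "chains \<kk> \<iota> = {V.
    (\<forall>\<alpha>\<in>ON. vectorspace (\<kk> \<alpha>) (space V \<alpha>) \<and> is_set (carrier (space V \<alpha>))) \<and>
    (\<forall>\<alpha>\<in>ON. \<forall>\<beta>\<in>ON. \<alpha> \<preceq> \<beta> \<longrightarrow>
      transition V \<beta> \<alpha> \<in> module_hom (\<kk> \<alpha>) (space V \<alpha>) (restrict_scalars (\<iota> \<beta> \<alpha>) (space V \<beta>))) \<and>
    (\<forall>\<alpha>\<in>ON. \<forall>v\<in>carrier (space V \<alpha>). transition V \<alpha> \<alpha> v = v) \<and>
    (\<forall>\<alpha>\<in>ON. \<forall>\<beta>\<in>ON. \<forall>\<gamma>\<in>ON. \<alpha> \<preceq> \<beta> \<and> \<beta> \<preceq> \<gamma> \<longrightarrow>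
      (\<forall>v\<in>carrier (space V \<alpha>). transition V \<gamma> \<beta> (transition V \<beta> \<alpha> v) = transition V \<gamma> \<alpha> v))}"

text \<open>Morphisms are extensional families (undefined outside \<open>ON\<close> and outside the carriers), so
  that equality of morphisms is equality of the components as maps.\<close>

definition chain_hom ::
  "('u::zfc \<Rightarrow> 'u ring) \<Rightarrow> 'u chain \<Rightarrow> 'u chain \<Rightarrow> ('u \<Rightarrow> 'u \<Rightarrow> 'u) set" where
  "chain_hom \<kk> V W = {f \<in> extensional ON.
    (\<forall>\<alpha>\<in>ON. f \<alpha> \<in> module_hom (\<kk> \<alpha>) (space V \<alpha>) (space W \<alpha>) \<inter> extensional (carrier (space V \<alpha>))) \<and>
    (\<forall>\<alpha>\<in>ON. \<forall>\<beta>\<in>ON. \<alpha> \<preceq> \<beta> \<longrightarrow>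
      (\<forall>v\<in>carrier (space V \<alpha>). f \<beta> (transition V \<beta> \<alpha> v) = transition W \<beta> \<alpha> (f \<alpha> v)))}"

definition chain_category ::
  "('u::zfc \<Rightarrow> 'u ring) \<Rightarrow> ('u \<Rightarrow> 'u \<Rightarrow> 'u \<Rightarrow> 'u) \<Rightarrow> ('u chain, 'u \<Rightarrow> 'u \<Rightarrow> 'u) category" where
  "chain_category \<kk> \<iota> = \<lparr>
    Ob = chains \<kk> \<iota>,
    Hom = chain_hom \<kk>,
    Id = (\<lambda>V. \<lambda>\<alpha>\<in>ON. \<lambda>v\<in>carrier (space V \<alpha>). v),
    Comp = (\<lambda>U V W g f. \<lambda>\<alpha>\<in>ON. compose (carrier (space U \<alpha>)) (g \<alpha>) (f \<alpha>))\<rparr>"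

definition grounded :: "('u::zfc \<Rightarrow> 'u ring) \<Rightarrow> 'u \<Rightarrow> 'u chain \<Rightarrow> bool" where
  "grounded \<kk> \<alpha> V \<longleftrightarrow> (\<forall>\<beta>\<in>ON. \<alpha> \<prec> \<beta> \<longrightarrow>
    carrier (space V \<beta>) =
      module.span (\<kk> \<beta>) (space V \<beta>) (transition V \<beta> \<alpha> ` carrier (space V \<alpha>)))"

definition grounded_category :: "('u::zfc \<Rightarrow> 'u ring) \<Rightarrow> ('u \<Rightarrow> 'u \<Rightarrow> 'u \<Rightarrow> 'u) \<Rightarrow> 'u \<Rightarrow>
    ('u chain, 'u \<Rightarrow> 'u \<Rightarrow> 'u) category" where
  "grounded_category \<kk> \<iota> \<alpha> = full_subcategory (chain_category \<kk> \<iota>) (grounded \<kk> \<alpha>)"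

lemma transition_in_space:
  assumes "V \<in> chains \<kk> \<iota>" "\<alpha> \<in> ON" "\<beta> \<in> ON" "\<alpha> \<preceq> \<beta>" "v \<in> carrier (space V \<alpha>)"
  shows "transition V \<beta> \<alpha> v \<in> carrier (space V \<beta>)"
proof -
  have "transition V \<beta> \<alpha> \<in> module_hom (\<kk> \<alpha>) (space V \<alpha>) (restrict_scalars (\<iota> \<beta> \<alpha>) (space V \<beta>))"
    using assms by (simp add: chains_def)
  then show ?thesis
    using assms(5) by (auto simp: module_hom_def restrict_scalars_def)
qed

lemma chain_hom_in_space:
  assumes "f \<in> chain_hom \<kk> V W" "\<alpha> \<in> ON" "v \<in> carrier (space V \<alpha>)"
  shows "f \<alpha> v \<in> carrier (space W \<alpha>)"
  using assms by (auto simp: chain_hom_def module_hom_def)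

lemma chain_module:
  assumes "V \<in> chains \<kk> \<iota>" "\<alpha> \<in> ON"
  shows "module (\<kk> \<alpha>) (space V \<alpha>)"
  using assms by (auto simp: chains_def vectorspace_def)

lemma category_chain_category: "category (chain_category \<kk> \<iota>)"
proof
  fix X assume "X \<in> Ob (chain_category \<kk> \<iota>)"
  then have X: "X \<in> chains \<kk> \<iota>" by (simp add: chain_category_def)
  have "(\<lambda>v\<in>carrier (space X \<alpha>). v) \<in> module_hom (\<kk> \<alpha>) (space X \<alpha>) (space X \<alpha>)"
    if "\<alpha> \<in> ON" for \<alpha>
  proof -
    interpret module "\<kk> \<alpha>" "space X \<alpha>" using chain_module[OF X that] .
    show ?thesis by (auto simp: module_hom_def)
  qed
  then show "Id (chain_category \<kk> \<iota>) X \<in> Hom (chain_category \<kk> \<iota>) X X"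
    using transition_in_space[OF X] by (auto simp: chain_category_def chain_hom_def)
next
  fix X Y Z f g
  assume "X \<in> Ob (chain_category \<kk> \<iota>)" "Y \<in> Ob (chain_category \<kk> \<iota>)"
    and "f \<in> Hom (chain_category \<kk> \<iota>) X Y" "g \<in> Hom (chain_category \<kk> \<iota>) Y Z"
  then have X: "X \<in> chains \<kk> \<iota>" and Y: "Y \<in> chains \<kk> \<iota>"
    and f: "f \<in> chain_hom \<kk> X Y" and g: "g \<in> chain_hom \<kk> Y Z"
    by (simp_all add: chain_category_def)
  have "compose (carrier (space X \<alpha>)) (g \<alpha>) (f \<alpha>) \<in> module_hom (\<kk> \<alpha>) (space X \<alpha>) (space Z \<alpha>)"
    if "\<alpha> \<in> ON" for \<alpha>
  proof -
    interpret module "\<kk> \<alpha>" "space X \<alpha>" using chain_module[OF X that] .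
    have "f \<alpha> \<in> module_hom (\<kk> \<alpha>) (space X \<alpha>) (space Y \<alpha>)"
      "g \<alpha> \<in> module_hom (\<kk> \<alpha>) (space Y \<alpha>) (space Z \<alpha>)"
      using f g that by (auto simp: chain_hom_def)
    then show ?thesis by (auto simp: module_hom_def compose_def Pi_iff)
  qed
  moreover have "g \<beta> (f \<beta> (transition X \<beta> \<alpha> v)) = transition Z \<beta> \<alpha> (g \<alpha> (f \<alpha> v))"
    if "\<alpha> \<in> ON" "\<beta> \<in> ON" "\<alpha> \<preceq> \<beta>" "v \<in> carrier (space X \<alpha>)" for \<alpha> \<beta> v
  proof -
    have "f \<beta> (transition X \<beta> \<alpha> v) = transition Y \<beta> \<alpha> (f \<alpha> v)"
      using f that by (auto simp: chain_hom_def)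
    then show ?thesis
      using g that chain_hom_in_space[OF f] by (auto simp: chain_hom_def)
  qed
  ultimately show "Comp (chain_category \<kk> \<iota>) X Y Z g f \<in> Hom (chain_category \<kk> \<iota>) X Z"
    using transition_in_space[OF X]
    by (auto simp: chain_category_def chain_hom_def compose_def)
next
  fix X Y f
  assume "f \<in> Hom (chain_category \<kk> \<iota>) X Y"
  then have f: "f \<in> chain_hom \<kk> X Y" by (simp add: chain_category_def)
  then have ext: "f \<alpha> v = undefined" if "\<alpha> \<in> ON" "v \<notin> carrier (space X \<alpha>)" for \<alpha> v
    using that by (auto simp: chain_hom_def extensional_def)
  have ext': "f \<alpha> = undefined" if "\<alpha> \<notin> ON" for \<alpha>
    using f that by (auto simp: chain_hom_def extensional_def)
  show "Comp (chain_category \<kk> \<iota>) X X Y f (Id (chain_category \<kk> \<iota>) X) = f"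
    by (intro HOL.ext) (auto simp: chain_category_def compose_def restrict_def ext ext')
  show "Comp (chain_category \<kk> \<iota>) X Y Y (Id (chain_category \<kk> \<iota>) Y) f = f"
    using chain_hom_in_space[OF f]
    by (intro HOL.ext) (auto simp: chain_category_def compose_def restrict_def ext ext')
next
  fix W X Y Z f g h
  assume "f \<in> Hom (chain_category \<kk> \<iota>) W X"
  then have f: "f \<in> chain_hom \<kk> W X" by (simp add: chain_category_def)
  show "Comp (chain_category \<kk> \<iota>) W Y Z h (Comp (chain_category \<kk> \<iota>) W X Y g f) =
    Comp (chain_category \<kk> \<iota>) W X Z (Comp (chain_category \<kk> \<iota>) X Y Z h g) f"
    using chain_hom_in_space[OF f]
    by (intro HOL.ext) (auto simp: chain_category_def compose_def restrict_def)
qed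

lemma category_grounded_category: "category (grounded_category \<kk> \<iota> \<alpha>)"
  using category_chain_category[of \<kk> \<iota>]
  unfolding category_def grounded_category_def full_subcategory_def by simp

end

theory Submission
  imports Defs
begin

text \<open>
  In an abelian category a morphism that is both monic and epic is invertible. A morphism out of an
  \<open>\<alpha>\<close>-grounded chain is determined by its components at the indices not above \<open>\<alpha>\<close>, so a
  morphism of \<open>\<alpha>\<close>-grounded chains that is injective at those indices is monic, even if it is not
  injective above \<open>\<alpha>\<close>. This happens for the quotient map from the tower itself, seen as a chain
  of one-dimensional spaces, to its truncation, in which all the spaces above \<open>\<alpha>\<close> are replaced
  by zero.
\<close>

section \<open>Monic epic morphisms\<close>

text \<open>If \<open>g f\<close> factors through a zero object \<open>N\<close> as
  \<open>h k\<close>, then any \<open>l\<close> from \<open>Y\<close> to \<open>N\<close> satisfies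
  \<open>l f = k\<close>, because maps into \<open>N\<close> are unique. Hence
  \<open>(h l) f = g f\<close>, and cancelling \<open>f\<close> exhibits \<open>g\<close> as
  \<open>h l\<close>.\<close>

lemma zero_morphism_cancel_epic:
  assumes "category C" "epic C X Y f" "X \<in> Ob C" "Y \<in> Ob C" "Z \<in> Ob C" "g \<in> Hom C Y Z"
    and "zero_morphism C X Z (Comp C X Y Z g f)"
  shows "zero_morphism C Y Z g"
proof -
  interpret category C by fact
  have f: "f \<in> Hom C X Y"
    and cancel: "\<And>h h'. \<lbrakk>h \<in> Hom C Y Z; h' \<in> Hom C Y Z; Comp C X Y Z h f = Comp C X Y Z h' f\<rbrakk> \<Longrightarrow> h = h'"
    using assms unfolding epic_def by blast+
  obtain N k h where N: "zero_object C N" and k: "k \<in> Hom C X N" and h: "h \<in> Hom C N Z"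
    and gf: "Comp C X Y Z g f = Comp C X N Z h k"
    using assms(7) unfolding zero_morphism_def by blast
  have NOb: "N \<in> Ob C" and unique: "\<exists>!l. l \<in> Hom C X N"
    using N \<open>X \<in> Ob C\<close> by (auto simp: zero_object_def)
  obtain l where l: "l \<in> Hom C Y N"
    using N \<open>Y \<in> Ob C\<close> by (auto simp: zero_object_def)
  have "Comp C X Y N l f = k"
    using unique k Comp_in_Hom[OF \<open>X \<in> Ob C\<close> \<open>Y \<in> Ob C\<close> NOb f l] by blast
  then have "Comp C X Y Z (Comp C Y N Z h l) f = Comp C X Y Z g f"
    using Comp_assoc[OF \<open>X \<in> Ob C\<close> \<open>Y \<in> Ob C\<close> NOb \<open>Z \<in> Ob C\<close> f l h] gf by simp
  then have "Comp C Y N Z h l = g"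
    using cancel Comp_in_Hom[OF \<open>Y \<in> Ob C\<close> NOb \<open>Z \<in> Ob C\<close> l h] \<open>g \<in> Hom C Y Z\<close> by blast
  then show ?thesis
    using N l h unfolding zero_morphism_def by blast
qed

text \<open>The monic \<open>f\<close> is a kernel of some \<open>g\<close>. As \<open>g f\<close>
  is zero and \<open>f\<close> is epic, \<open>g\<close> is zero, so the identity of
  \<open>Y\<close> is itself killed by \<open>g\<close> and factors through the kernel
  \<open>f\<close>; the factor is \<open>u\<close>.\<close>

lemma abelian_monic_epic_right_inverse:
  assumes "abelian_category C" "monic C X Y f" "epic C X Y f" "X \<in> Ob C" "Y \<in> Ob C"
  obtains u where "u \<in> Hom C Y X" "Comp C Y X Y f u = Id C Y"
proof -
  have C: "category C"
    using assms(1) by (simp add: abelian_category_def)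
  then interpret category C .
  obtain Z g where Z: "Z \<in> Ob C" "g \<in> Hom C Y Z" and ker: "is_kernel C Y Z g X f"
    using assms unfolding abelian_category_def by blast
  have "zero_morphism C Y Z g"
    using zero_morphism_cancel_epic[OF C assms(3-5) Z] ker by (simp add: is_kernel_def)
  then have "zero_morphism C Y Z (Comp C Y Y Z g (Id C Y))"
    using Comp_Id Z \<open>Y \<in> Ob C\<close> by simp
  then show thesis
    using ker Id_in_Hom[OF \<open>Y \<in> Ob C\<close>] \<open>Y \<in> Ob C\<close> that unfolding is_kernel_def by blast
qed

section \<open>Ordinals\<close>

text \<open>Foundation applied to the singleton of \<open>x\<close>, whose only member would meet it
  in \<open>x\<close>.\<close>

lemma elt_irrefl: "\<not> (x::'u::zfc) \<epsilon> x"
proof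
  assume "x \<epsilon> x"
  obtain p where p: "\<And>z. z \<epsilon> p \<longleftrightarrow> z = x"
    using pairing[of x x] by auto
  then show False
    using foundation[of p] \<open>x \<epsilon> x\<close> by auto
qed

text \<open>Serves for the carriers of the zero spaces, which must be sets.\<close>

lemma is_set_singleton: "is_set {x}"
  using pairing[of x x] by (auto simp: is_set_def)

lemma ON_less_trans:
  assumes "\<gamma> \<in> ON" "\<alpha> \<prec> \<beta>" "\<beta> \<preceq> \<gamma>"
  shows "\<alpha> \<prec> \<gamma>"
proof -
  have "transitive \<gamma>"
    using assms(1) by (simp add: ON_def)
  then show ?thesis
    using assms(2,3) unfolding transitive_def ord_le_def by blast
qed

lemma ON_successor:
  assumes "(\<alpha>::'u::zfc) \<in> ON"
  obtains \<beta> where "\<beta> \<in> ON" "\<alpha> \<prec> \<beta>"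
proof -
  \<comment> \<open>The von Neumann successor: \<open>s\<close> is {\<alpha>}, \<open>p\<close> is
    {\<alpha>, {\<alpha>}}, and the union of \<open>p\<close> is \<alpha> \<union>
    {\<alpha>}.\<close>
  obtain s where s: "\<And>z. z \<epsilon> s \<longleftrightarrow> z = \<alpha>"
    using pairing[of \<alpha> \<alpha>] by auto
  obtain p where p: "\<And>z. z \<epsilon> p \<longleftrightarrow> z = \<alpha> \<or> z = s"
    using pairing[of \<alpha> s] by auto
  obtain \<beta> where \<beta>: "\<And>z. z \<epsilon> \<beta> \<longleftrightarrow> (\<exists>y. y \<epsilon> p \<and> z \<epsilon> y)"
    using union[of p] by auto
  have "z \<epsilon> \<beta> \<longleftrightarrow> z \<epsilon> \<alpha> \<or> z = \<alpha>" for z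
    using \<beta> p s by auto
  then have "\<beta> \<in> ON" "\<alpha> \<prec> \<beta>"
    using assms unfolding ON_def transitive_def by blast+
  then show thesis ..
qed

section \<open>Linear maps\<close>

lemma equalizer_submodule:
  assumes "module R M" "module R N" "f \<in> module_hom R M N" "g \<in> module_hom R M N"
  shows "submodule R {v \<in> carrier M. f v = g v} M"
proof -
  interpret M: module R M by fact
  interpret N: module R N by fact
  interpret f: mod_hom R M N f
    by unfold_locales fact
  interpret g: mod_hom R M N g
    by unfold_locales fact
  show ?thesis
    by unfold_locales auto
qed

text \<open>The equalizer of the two maps is a submodule containing \<open>S\<close>, hence contains
  the span. This is how groundedness of a chain gets exploited.\<close>

lemma module_hom_eq_on_span:
  assumes "module R M" "module R N" "f \<in> module_hom R M N" "g \<in> module_hom R M N"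
    and "S \<subseteq> carrier M" "\<And>v. v \<in> S \<Longrightarrow> f v = g v" "v \<in> module.span R M S"
  shows "f v = g v"
proof -
  have "module.span R M S \<subseteq> {v \<in> carrier M. f v = g v}"
    using assms by (intro module.span_is_subset equalizer_submodule) auto
  then show ?thesis
    using assms by blast
qed

section \<open>The field as a space over itself, and its zero subspace\<close>

definition regular_module :: "'a ring \<Rightarrow> ('a, 'a) module" where
  "regular_module R = \<lparr>carrier = carrier R, mult = mult R, one = one R, zero = zero R,
    add = add R, smult = mult R\<rparr>"

lemma regular_module_simps [simp]:
  "carrier (regular_module R) = carrier R"
  "zero (regular_module R) = zero R"
  "add (regular_module R) = add R"
  "smult (regular_module R) = mult R"
  by (simp_all add: regular_module_def)

lemma vectorspace_regular_module:
  assumes "field R"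
  shows "vectorspace R (regular_module R)"
proof -
  interpret field R by fact
  have "abelian_group (regular_module R)"
    by (rule abelian_groupI) (auto simp: a_ac intro: add.l_inv_ex)
  then have "module R (regular_module R)"
    by (intro moduleI is_cring) (auto simp: l_distr r_distr m_assoc)
  then show ?thesis
    using assms by (simp add: vectorspace_def)
qed

lemma vectorspace_zero_module:
  assumes "field R"
  shows "vectorspace R (regular_module R\<lparr>carrier := {\<zero>\<^bsub>R\<^esub>}\<rparr>)"
proof -
  interpret field R by fact
  interpret V: vectorspace R "regular_module R"
    using vectorspace_regular_module[OF assms] .
  have "submodule R {\<zero>\<^bsub>R\<^esub>} (regular_module R)"
    by unfold_locales auto
  then show ?thesis
    by (intro V.subspace_is_vs) (simp add: subspace_def V.vectorspace_axioms)
qed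

section \<open>Truncations of the tower\<close>

text \<open>The tower with its spaces at the indices in \<open>D\<close> replaced by zero. The case
  \<open>D = {}\<close> is the tower itself, so one construction yields both source and target of
  the quotient map.\<close>

definition truncation ::
  "('u::zfc \<Rightarrow> 'u ring) \<Rightarrow> ('u \<Rightarrow> 'u \<Rightarrow> 'u \<Rightarrow> 'u) \<Rightarrow> 'u set \<Rightarrow> 'u chain" where
  "truncation \<kk> \<iota> D = \<lparr>
    space = (\<lambda>\<gamma>. if \<gamma> \<in> D then regular_module (\<kk> \<gamma>)\<lparr>carrier := {\<zero>\<^bsub>\<kk> \<gamma>\<^esub>}\<rparr>
      else regular_module (\<kk> \<gamma>)),
    transition = (\<lambda>\<beta> \<gamma>. if \<beta> \<in> D then \<lambda>_. \<zero>\<^bsub>\<kk> \<beta>\<^esub> else \<iota> \<beta> \<gamma>)\<rparr>"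

lemma truncation_space:
  "carrier (space (truncation \<kk> \<iota> D) \<gamma>) = (if \<gamma> \<in> D then {\<zero>\<^bsub>\<kk> \<gamma>\<^esub>} else carrier (\<kk> \<gamma>))"
  "zero (space (truncation \<kk> \<iota> D) \<gamma>) = \<zero>\<^bsub>\<kk> \<gamma>\<^esub>"
  "add (space (truncation \<kk> \<iota> D) \<gamma>) = add (\<kk> \<gamma>)"
  "smult (space (truncation \<kk> \<iota> D) \<gamma>) = mult (\<kk> \<gamma>)"
  by (simp_all add: truncation_def)

lemma truncation_transition:
  "transition (truncation \<kk> \<iota> D) \<beta> \<gamma> = (if \<beta> \<in> D then \<lambda>_. \<zero>\<^bsub>\<kk> \<beta>\<^esub> else \<iota> \<beta> \<gamma>)"
  by (simp add: truncation_def)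

text \<open>Once a truncation becomes zero it must stay zero: otherwise a composite passing through
  a zero space would differ from the direct inclusion.\<close>

definition up_closed :: "'u::zfc set \<Rightarrow> bool" where
  "up_closed D \<longleftrightarrow> (\<forall>\<beta>\<in>ON. \<forall>\<gamma>\<in>ON. \<beta> \<in> D \<longrightarrow> \<beta> \<preceq> \<gamma> \<longrightarrow> \<gamma> \<in> D)"

text \<open>The quotient map out of the tower. Both abstractions are restricted because morphisms of
  chains are extensional families.\<close>

definition truncation_map ::
  "('u::zfc \<Rightarrow> 'u ring) \<Rightarrow> 'u set \<Rightarrow> 'u \<Rightarrow> 'u \<Rightarrow> 'u" where
  "truncation_map \<kk> D = (\<lambda>\<gamma>\<in>ON. \<lambda>v\<in>carrier (\<kk> \<gamma>). if \<gamma> \<in> D then \<zero>\<^bsub>\<kk> \<gamma>\<^esub> else v)"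

context field_tower
begin

lemma truncation_in_chains:
  assumes "up_closed D"
  shows "truncation \<kk> \<iota> D \<in> chains \<kk> \<iota>"
proof -
  let ?V = "truncation \<kk> \<iota> D"
  have "vectorspace (\<kk> \<gamma>) (space ?V \<gamma>)" "is_set (carrier (space ?V \<gamma>))" if "\<gamma> \<in> ON" for \<gamma>
    using that field is_set is_set_singleton
    by (auto simp: truncation_def vectorspace_regular_module vectorspace_zero_module)
  moreover have "transition ?V \<beta> \<gamma> \<in>
      module_hom (\<kk> \<gamma>) (space ?V \<gamma>) (restrict_scalars (\<iota> \<beta> \<gamma>) (space ?V \<beta>))"
    if "\<gamma> \<in> ON" "\<beta> \<in> ON" "\<gamma> \<preceq> \<beta>" for \<gamma> \<beta>
  proof -
    interpret K: field "\<kk> \<gamma>" using field that by blast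
    interpret L: field "\<kk> \<beta>" using field that by blast
    interpret \<iota>: ring_hom_ring "\<kk> \<gamma>" "\<kk> \<beta>" "\<iota> \<beta> \<gamma>"
      using hom[OF that] by unfold_locales
    \<comment> \<open>Leaves only the inclusion between two full spaces and maps into a zero
      space.\<close>
    have "\<beta> \<in> D" if "\<gamma> \<in> D"
      using that assms \<open>\<gamma> \<in> ON\<close> \<open>\<beta> \<in> ON\<close> \<open>\<gamma> \<preceq> \<beta>\<close> unfolding up_closed_def by blast
    then show ?thesis
      by (auto simp: module_hom_def restrict_scalars_def truncation_space truncation_transition)
  qed
  moreover have "transition ?V \<gamma> \<gamma> v = v" if "\<gamma> \<in> ON" "v \<in> carrier (space ?V \<gamma>)" for \<gamma> v
    using that id by (auto simp: truncation_space truncation_transition split: if_splits)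
  moreover have "transition ?V \<gamma> \<beta> (transition ?V \<beta> \<alpha> v) = transition ?V \<gamma> \<alpha> v"
    if "\<alpha> \<in> ON" "\<beta> \<in> ON" "\<gamma> \<in> ON" "\<alpha> \<preceq> \<beta>" "\<beta> \<preceq> \<gamma>" "v \<in> carrier (space ?V \<alpha>)" for \<alpha> \<beta> \<gamma> v
  proof (cases "\<gamma> \<in> D")
    case False
    \<comment> \<open>Up-closure read backwards, so all three transitions are inclusions of the
      tower.\<close>
    then have "\<beta> \<notin> D" "\<alpha> \<notin> D"
      using that assms False unfolding up_closed_def ord_le_def by metis+
    then show ?thesis
      using that False comp by (simp add: truncation_space truncation_transition)
  qed (simp add: truncation_transition)
  ultimately show ?thesis
    by (auto simp: chains_def)
qed

text \<open>At an index in \<open>D\<close> the zero space is spanned by anything; elsewhere the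
  image of 1 is 1, which spans the one-dimensional space.\<close>

lemma grounded_truncation:
  assumes "up_closed D" "\<alpha> \<in> ON"
  shows "grounded \<kk> \<alpha> (truncation \<kk> \<iota> D)"
  unfolding grounded_def
proof (intro ballI impI)
  fix \<beta> :: 'u assume \<beta>: "\<beta> \<in> ON" "\<alpha> \<prec> \<beta>"
  let ?V = "truncation \<kk> \<iota> D"
  let ?S = "transition ?V \<beta> \<alpha> ` carrier (space ?V \<alpha>)"
  interpret K: field "\<kk> \<alpha>" using field assms by blast
  interpret L: field "\<kk> \<beta>" using field \<beta> by blast
  interpret M: module "\<kk> \<beta>" "space ?V \<beta>"
    using chain_module[OF truncation_in_chains] assms \<beta> by blast
  have le: "\<alpha> \<preceq> \<beta>" using \<beta> by (simp add: ord_le_def)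
  have S: "?S \<subseteq> carrier (space ?V \<beta>)"
    using transition_in_space[OF truncation_in_chains] assms \<beta> le by blast
  interpret span: submodule "\<kk> \<beta>" "M.span ?S" "space ?V \<beta>"
    using M.span_is_submodule[OF S] .
  have "v \<in> M.span ?S" if v: "v \<in> carrier (space ?V \<beta>)" for v
  proof (cases "\<beta> \<in> D")
    case True
    then show ?thesis
      using v span.zero_closed by (simp add: truncation_space)
  next
    case False
    then have "\<alpha> \<notin> D"
      using assms \<beta> le unfolding up_closed_def by blast
    then have "\<iota> \<beta> \<alpha> \<one>\<^bsub>\<kk> \<alpha>\<^esub> \<in> ?S"
      using False by (simp add: truncation_space truncation_transition)
    then have "\<one>\<^bsub>\<kk> \<beta>\<^esub> \<in> M.span ?S"
      using M.in_own_span[OF S] ring_hom_one[OF hom] assms \<beta> le by auto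
    then have "v \<otimes>\<^bsub>\<kk> \<beta>\<^esub> \<one>\<^bsub>\<kk> \<beta>\<^esub> \<in> M.span ?S"
      using span.smult_closed[of v "\<one>\<^bsub>\<kk> \<beta>\<^esub>"] v False by (simp add: truncation_space)
    then show ?thesis
      using v False by (simp add: truncation_space)
  qed
  then show "carrier (space ?V \<beta>) = M.span ?S"
    using span.subset by blast
qed

section \<open>The quotient map: monic and epic, but without a right inverse\<close>

lemma truncation_map_in_chain_hom:
  assumes "up_closed D"
  shows "truncation_map \<kk> D \<in> chain_hom \<kk> (truncation \<kk> \<iota> {}) (truncation \<kk> \<iota> D)"
proof -
  have "truncation_map \<kk> D \<gamma> \<in> module_hom (\<kk> \<gamma>) (space (truncation \<kk> \<iota> {}) \<gamma>)
      (space (truncation \<kk> \<iota> D) \<gamma>)" if "\<gamma> \<in> ON" for \<gamma>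
  proof -
    interpret field "\<kk> \<gamma>" using field that by blast
    show ?thesis
      using that by (auto simp: module_hom_def truncation_map_def truncation_space)
  qed
  moreover have "\<iota> \<beta> \<gamma> v \<in> carrier (\<kk> \<beta>)"
    if "\<gamma> \<in> ON" "\<beta> \<in> ON" "\<gamma> \<preceq> \<beta>" "v \<in> carrier (\<kk> \<gamma>)" for \<beta> \<gamma> v
    using ring_hom_closed[OF hom] that by blast
  moreover have "\<beta> \<in> D" if "\<gamma> \<in> ON" "\<beta> \<in> ON" "\<gamma> \<preceq> \<beta>" "\<gamma> \<in> D" for \<beta> \<gamma>
    using assms that unfolding up_closed_def by blast
  ultimately show ?thesis
    by (auto simp: chain_hom_def truncation_map_def truncation_space truncation_transition)
qed

text \<open>Every component is onto: it fixes each element of the target space, which is contained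
  in the source space.\<close>

lemma epic_truncation_map:
  assumes "up_closed D"
  shows "epic (grounded_category \<kk> \<iota> \<alpha>) (truncation \<kk> \<iota> {}) (truncation \<kk> \<iota> D) (truncation_map \<kk> D)"
proof -
  let ?V = "truncation \<kk> \<iota> {}" and ?W = "truncation \<kk> \<iota> D" and ?q = "truncation_map \<kk> D"
  have "g = h"
    if g: "g \<in> chain_hom \<kk> ?W T" and h: "h \<in> chain_hom \<kk> ?W T"
      and eq: "Comp (chain_category \<kk> \<iota>) ?V ?W T g ?q = Comp (chain_category \<kk> \<iota>) ?V ?W T h ?q"
    for T g h
  proof (rule extensionalityI[of _ ON])
    fix \<gamma> :: 'u assume \<gamma>: "\<gamma> \<in> ON"
    interpret field "\<kk> \<gamma>" using field \<gamma> by blast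
    have comp: "g \<gamma> (?q \<gamma> v) = h \<gamma> (?q \<gamma> v)" if "v \<in> carrier (\<kk> \<gamma>)" for v
      using fun_cong[OF fun_cong[OF eq], of \<gamma> v] \<gamma> that
      by (simp add: chain_category_def compose_def truncation_space)
    show "g \<gamma> = h \<gamma>"
    proof (rule extensionalityI[of _ "carrier (space ?W \<gamma>)"])
      fix w assume w: "w \<in> carrier (space ?W \<gamma>)"
      then have "w \<in> carrier (\<kk> \<gamma>)" "?q \<gamma> w = w"
        using \<gamma> by (auto simp: truncation_space truncation_map_def split: if_splits)
      then show "g \<gamma> w = h \<gamma> w"
        using comp by metis
    qed (use g h \<gamma> in \<open>auto simp: chain_hom_def\<close>)
  qed (use g h in \<open>auto simp: chain_hom_def\<close>)
  then show ?thesis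
    using truncation_map_in_chain_hom[OF assms]
    by (auto simp: epic_def grounded_category_def full_subcategory_def chain_category_def)
qed

text \<open>Outside \<open>D\<close> the components are identities, so \<open>g\<close> and
  \<open>h\<close> agree there, in particular at \<alpha>. The indices in \<open>D\<close> lie above
  \<alpha>, where the grounded test chain \<open>T\<close> is spanned by the image of its space at
  \<alpha>.\<close>

lemma monic_truncation_map:
  assumes "\<alpha> \<in> ON" "up_closed D" "\<And>\<gamma>. \<lbrakk>\<gamma> \<in> ON; \<gamma> \<in> D\<rbrakk> \<Longrightarrow> \<alpha> \<prec> \<gamma>"
  shows "monic (grounded_category \<kk> \<iota> \<alpha>) (truncation \<kk> \<iota> {}) (truncation \<kk> \<iota> D) (truncation_map \<kk> D)"
proof -
  let ?V = "truncation \<kk> \<iota> {}" and ?W = "truncation \<kk> \<iota> D" and ?q = "truncation_map \<kk> D"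
  have "\<alpha> \<notin> D"
    using assms elt_irrefl by blast
  have V: "?V \<in> chains \<kk> \<iota>"
    by (rule truncation_in_chains) (simp add: up_closed_def)
  have "g = h"
    if T: "T \<in> chains \<kk> \<iota>" "grounded \<kk> \<alpha> T"
      and g: "g \<in> chain_hom \<kk> T ?V" and h: "h \<in> chain_hom \<kk> T ?V"
      and eq: "Comp (chain_category \<kk> \<iota>) T ?V ?W ?q g = Comp (chain_category \<kk> \<iota>) T ?V ?W ?q h"
    for T g h
  proof -
    have below: "g \<gamma> v = h \<gamma> v" if "\<gamma> \<in> ON" "\<gamma> \<notin> D" "v \<in> carrier (space T \<gamma>)" for \<gamma> v
    proof -
      have "g \<gamma> v \<in> carrier (\<kk> \<gamma>)" "h \<gamma> v \<in> carrier (\<kk> \<gamma>)"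
        using chain_hom_in_space[OF g] chain_hom_in_space[OF h] that
        by (auto simp: truncation_space)
      then show ?thesis
        using fun_cong[OF fun_cong[OF eq], of \<gamma> v] that
        by (simp add: chain_category_def compose_def truncation_map_def)
    qed
    have above: "g \<gamma> v = h \<gamma> v" if "\<gamma> \<in> ON" "\<gamma> \<in> D" "v \<in> carrier (space T \<gamma>)" for \<gamma> v
    proof -
      have less: "\<alpha> \<prec> \<gamma>" and le: "\<alpha> \<preceq> \<gamma>"
        using assms that by (auto simp: ord_le_def)
      let ?S = "transition T \<gamma> \<alpha> ` carrier (space T \<alpha>)"
      have v: "v \<in> module.span (\<kk> \<gamma>) (space T \<gamma>) ?S"
        using T(2) that less unfolding grounded_def by blast
      have S: "?S \<subseteq> carrier (space T \<gamma>)"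
        using transition_in_space[OF T(1)] assms(1) that le by blast
      \<comment> \<open>Naturality of \<open>g\<close> and \<open>h\<close> carries the comparison
        down to \<alpha>, which is outside \<open>D\<close>.\<close>
      have eq_S: "g \<gamma> w = h \<gamma> w" if "w \<in> ?S" for w
        using that below[OF \<open>\<alpha> \<in> ON\<close> \<open>\<alpha> \<notin> D\<close>] g h assms(1) \<open>\<gamma> \<in> ON\<close> le
        by (auto simp: chain_hom_def)
      have homs: "g \<gamma> \<in> module_hom (\<kk> \<gamma>) (space T \<gamma>) (space ?V \<gamma>)"
        "h \<gamma> \<in> module_hom (\<kk> \<gamma>) (space T \<gamma>) (space ?V \<gamma>)"
        using g h that by (auto simp: chain_hom_def)
      show ?thesis
        using module_hom_eq_on_span[OF chain_module[OF T(1)] chain_module[OF V] homs S eq_S v] that(1)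
        by blast
    qed
    show ?thesis
    proof (rule extensionalityI[of _ ON])
      fix \<gamma> :: 'u assume \<gamma>: "\<gamma> \<in> ON"
      show "g \<gamma> = h \<gamma>"
        by (rule extensionalityI[of _ "carrier (space T \<gamma>)"])
          (use g h \<gamma> below above in \<open>auto simp: chain_hom_def\<close>)
    qed (use g h in \<open>auto simp: chain_hom_def\<close>)
  qed
  then show ?thesis
    using truncation_map_in_chain_hom[OF assms(2)]
    by (auto simp: monic_def grounded_category_def full_subcategory_def chain_category_def)
qed

text \<open>A right inverse \<open>u\<close> is the identity at \<alpha>. Going from \<alpha> to
  \<beta>, the element 1 dies in the truncation but survives in the tower, so \<open>u\<close> would
  have to send 0 to 1 at \<beta>.\<close>

lemma truncation_map_no_right_inverse:
  assumes "\<alpha> \<in> ON" "\<beta> \<in> ON" "\<alpha> \<preceq> \<beta>" "\<alpha> \<notin> D" "\<beta> \<in> D"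
    and u: "u \<in> chain_hom \<kk> (truncation \<kk> \<iota> D) (truncation \<kk> \<iota> {})"
  shows "Comp (chain_category \<kk> \<iota>) (truncation \<kk> \<iota> D) (truncation \<kk> \<iota> {}) (truncation \<kk> \<iota> D)
    (truncation_map \<kk> D) u \<noteq> Id (chain_category \<kk> \<iota>) (truncation \<kk> \<iota> D)"
    (is "?comp \<noteq> ?id")
proof
  assume eq: "?comp = ?id"
  interpret K: field "\<kk> \<alpha>" using field assms by blast
  interpret L: field "\<kk> \<beta>" using field assms by blast
  let ?W = "truncation \<kk> \<iota> D"
  have one: "\<one>\<^bsub>\<kk> \<alpha>\<^esub> \<in> carrier (space ?W \<alpha>)"
    using assms by (simp add: truncation_space)
  have "u \<alpha> \<one>\<^bsub>\<kk> \<alpha>\<^esub> \<in> carrier (\<kk> \<alpha>)"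
    using chain_hom_in_space[OF u \<open>\<alpha> \<in> ON\<close> one] by (simp add: truncation_space)
  then have "u \<alpha> \<one>\<^bsub>\<kk> \<alpha>\<^esub> = \<one>\<^bsub>\<kk> \<alpha>\<^esub>"
    using fun_cong[OF fun_cong[OF eq], of \<alpha> "\<one>\<^bsub>\<kk> \<alpha>\<^esub>"] one assms
    by (simp add: chain_category_def compose_def truncation_map_def)
  \<comment> \<open>Naturality of \<open>u\<close> at 1: the transition of its source is zero since
    \<beta> is in \<open>D\<close>, that of its target is the inclusion.\<close>
  then have "u \<beta> \<zero>\<^bsub>\<kk> \<beta>\<^esub> = \<iota> \<beta> \<alpha> \<one>\<^bsub>\<kk> \<alpha>\<^esub>"
    using u one assms by (force simp: chain_hom_def truncation_transition)
  also have "\<dots> = \<one>\<^bsub>\<kk> \<beta>\<^esub>"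
    using ring_hom_one[OF hom] assms by blast
  finally have "u \<beta> \<zero>\<^bsub>\<kk> \<beta>\<^esub> = \<one>\<^bsub>\<kk> \<beta>\<^esub>" .
  \<comment> \<open>Homogeneity for the scalar 0 and the vector 0 forces \<open>u\<close> to send 0
    to 0 at \<beta>.\<close>
  moreover have "u \<beta> (\<zero>\<^bsub>\<kk> \<beta>\<^esub> \<otimes>\<^bsub>\<kk> \<beta>\<^esub> \<zero>\<^bsub>\<kk> \<beta>\<^esub>) = \<zero>\<^bsub>\<kk> \<beta>\<^esub> \<otimes>\<^bsub>\<kk> \<beta>\<^esub> u \<beta> \<zero>\<^bsub>\<kk> \<beta>\<^esub>"
    using u assms by (auto simp: chain_hom_def module_hom_def truncation_space)
  ultimately show False
    by simp
qed

end

theorem corollary1p6: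
  fixes \<kk> :: "'u::zfc \<Rightarrow> 'u ring"
    and \<iota> :: "'u \<Rightarrow> 'u \<Rightarrow> 'u \<Rightarrow> 'u"
    and \<alpha> :: 'u
  assumes "field_tower \<kk> \<iota>"
    and "\<alpha> \<in> ON"
  shows "\<not> abelian_category (grounded_category \<kk> \<iota> \<alpha>)"
proof
  assume abelian: "abelian_category (grounded_category \<kk> \<iota> \<alpha>)"
  interpret field_tower \<kk> \<iota> by fact
  \<comment> \<open>Excludes \<alpha>, as monicity requires, but contains the successor of \<alpha>,
    where the right inverse fails.\<close>
  define D where "D = {\<gamma>. \<alpha> \<prec> \<gamma>}"
  have D: "up_closed D"
    using ON_less_trans by (auto simp: up_closed_def D_def)
  have Ob: "truncation \<kk> \<iota> D' \<in> Ob (grounded_category \<kk> \<iota> \<alpha>)" if "up_closed D'" for D'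
    using truncation_in_chains[OF that] grounded_truncation[OF that \<open>\<alpha> \<in> ON\<close>]
    by (simp add: grounded_category_def full_subcategory_def chain_category_def)
  have monic: "monic (grounded_category \<kk> \<iota> \<alpha>) (truncation \<kk> \<iota> {}) (truncation \<kk> \<iota> D)
      (truncation_map \<kk> D)"
    using monic_truncation_map[OF \<open>\<alpha> \<in> ON\<close> D] by (simp add: D_def)
  obtain u where u: "u \<in> Hom (grounded_category \<kk> \<iota> \<alpha>) (truncation \<kk> \<iota> D) (truncation \<kk> \<iota> {})"
    and inverse: "Comp (grounded_category \<kk> \<iota> \<alpha>) (truncation \<kk> \<iota> D) (truncation \<kk> \<iota> {})
      (truncation \<kk> \<iota> D) (truncation_map \<kk> D) u = Id (grounded_category \<kk> \<iota> \<alpha>) (truncation \<kk> \<iota> D)"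
    using abelian_monic_epic_right_inverse[OF abelian monic epic_truncation_map[OF D]]
      Ob[of "{}"] Ob[OF D] by (auto simp: up_closed_def)
  obtain \<beta> where "\<beta> \<in> ON" "\<alpha> \<prec> \<beta>"
    using ON_successor[OF \<open>\<alpha> \<in> ON\<close>] .
  then show False
    using truncation_map_no_right_inverse[of \<alpha> \<beta> D u] u inverse \<open>\<alpha> \<in> ON\<close> elt_irrefl[of \<alpha>]
    by (auto simp: D_def ord_le_def grounded_category_def full_subcategory_def chain_category_def)
qed

end
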